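(* Let $k\ge1$ and $n>k$ be integers, and let $\inf_{\mathbf G\ \mathrm{IID}}$ denote the infimum over all type distributions $\mathbf G$ for $n$ agents (with any finite number $m$ of types) satisfying $G_{1j}=\cdots=G_{nj}$ for all $j$. Then $$\inf_{\mathbf G\ \mathrm{IID}}\mathrm{innerLP}^{\mathsf{DP}/\mathsf{Proph}}_{k,n}(\mathbf G)=\mathrm{iidLP}^{\mathsf{DP}/\mathsf{Proph}}_{k,n},\qquad \inf_{\mathbf G\ \mathrm{IID}}\mathrm{innerLP}^{\mathsf{DP}/\mathsf{ExAnte}}_{k,n}(\mathbf G)=\mathrm{iidLP}^{\mathsf{DP}/\mathsf{ExAnte}}_{k,n},$$ $$\inf_{\mathbf G\ \mathrm{IID}}\sup_{J,\rho}\mathrm{innerLP}^{\mathsf{OST}(J,\rho)/\mathsf{Proph}}_{k,n}(\mathbf G)=\sup_{\tau}\mathrm{iidLP}^{\mathsf{OST}(\tau)/\mathsf{Proph}}_{k,n},\qquad \inf_{\mathbf G\ \mathrm{IID}}\sup_{J,\rho}\mathrm{innerLP}^{\mathsf{OST}(J,\rho)/\mathsf{ExAnte}}_{k,n}(\mathbf G)=\sup_{\tau}\mathrm{iidLP}^{\mathsf{OST}(\tau)/\mathsf{ExAnte}}_{k,n},$$ $$\inf_{\mathbf G\ \mathrm{IID}}\mathrm{innerLP}^{\mathsf{ST}/\mathsf{Proph}}_{k,n}(\mathbf G)=\mathrm{iidLP}^{\mathsf{ST}/\mathsf{Proph}}_{k,n},\qquad \inf_{\mathbf G\ \mathrm{IID}}\mathrm{innerLP}^{\mathsf{ST}/\mathsf{ExAnte}}_{k,n}(\mathbf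 G)=\mathrm{iidLP}^{\mathsf{ST}/\mathsf{ExAnte}}_{k,n},$$ where $J\in[m]$, $\rho\in(0,1]$ and $\tau\in(0,1]$.
   Context: $[n]=\{1,\dots,n\}$. $\mathrm{Ber}(p)$ is a Bernoulli random variable with mean $p$ (independent within sums); $\mathrm{Bin}(n,q)$ is a Binomial random variable with $n$ trials and success probability $q$. Type distributions $\mathbf G$ (for $n$ agents): a positive integer $m$ and numbers $G_{ij}$, $i\in[n]$, $j\in\{0,1,\dots,m\}$, with $0=G_{i0}\le G_{i1}\le\cdots\le G_{im}=1$ for every $i$. $\mathcal P^k_n$ is the set of pairs $(\mathbf x,\mathbf y)$ of real arrays $\mathbf x=(x^l_i)_{i\in[n],l\in[k]}$, $\mathbf y=(y^l_i)_{i\in[n],l\in[k]}$ such that $0\le y^l_i\le x^l_i$ for all $i,l$; $x^k_1=1$; $x^l_1=0$ for $l<k$; and $x^l_i=x^l_{i-1}-y^l_{i-1}+y^{l+1}_{i-1}$ for all $i>1$, $l\in[k]$, with the convention $y^{k+1}_{i}=0$. Inner problems. Put $Q_j=\mathbb E[\min\{\sum_{i=1}^n\mathrm{Ber}(G_{ij}),k\}]$ in problems with superscript "$/\mathsf{Proph}$" and $Q_j=\min\{\sum_{i=1}^nG_{ij},k\}$ in those with superscript "$/\mathsf{ExAnte}$". - $\mathrm{innerLP}^{\mathsf{DP}/\cdot}_{k,n}(\mathbf G)$: optimal value of maximizing $\theta$ over real $\theta$ and $(\mathbf x,\mathbf y)\in\mathcal P^k_n$ subject to $\theta Q_j\le\sum_{i=1}^n\sum_{l=1}^k\min\{y^l_i,G_{ij}x^l_i\}$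 for all $j\in[m]$. - $\mathrm{innerLP}^{\mathsf{OST}(J,\rho)/\cdot}_{k,n}(\mathbf G)$: the same problem with the additional constraints $y^l_i=((1-\rho)G_{i,J-1}+\rho G_{iJ})x^l_i$ for all $i,l$. - $\mathrm{innerLP}^{\mathsf{ST}/\cdot}_{k,n}(\mathbf G)$: supremum of $\theta$ over real $\theta$ and probability measures $\mu$ on $[m]\times(0,1]$ subject to $\theta Q_j\le\int\big(\sum_{i=1}^n\sum_{l=1}^k\min\{y^l_i(J,\rho),G_{ij}x^l_i(J,\rho)\}\big)d\mu(J,\rho)$ for all $j\in[m]$, where $(\mathbf x(J,\rho),\mathbf y(J,\rho))$ is the unique element of $\mathcal P^k_n$ with $y^l_i(J,\rho)=((1-\rho)G_{i,J-1}+\rho G_{iJ})x^l_i(J,\rho)$ for all $i,l$. IID (semi-infinite) problems. Put $Q(q)=\mathbb E[\min\{\mathrm{Bin}(n,q),k\}]$ for "$/\mathsf{Proph}$" and $Q(q)=\min\{nq,k\}$ for "$/\mathsf{ExAnte}$". - $\mathrm{iidLP}^{\mathsf{DP}/\cdot}_{k,n}$: optimal value of maximizing $\theta$ over real $\theta$ and $(\mathbf x,\mathbf y)\in\mathcal P^k_n$ subject to $\theta Q(q)\le\sum_{i=1}^n\sum_{l=1}^k\min\{y^l_i,qx^l_i\}$ for all $q\in(0,1]$. - $\mathrm{iidLP}^{\mathsf{OST}(\tau)/\cdot}_{k,n}$: the same problem with the additional constraints $y^l_i=\tau x^l_i$ for all $i,l$. - $\mathrm{iidLP}^{\mathsf{ST}/\cdot}_{k,n}$: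 supremum of $\theta$ over real $\theta$ and probability measures $\mu$ on $(0,1]$ subject to $\theta Q(q)\le\int\big(\sum_{i=1}^n\sum_{l=1}^k\min\{y^l_i(\tau),qx^l_i(\tau)\}\big)d\mu(\tau)$ for all $q\in(0,1]$, where $(\mathbf x(\tau),\mathbf y(\tau))$ is the unique element of $\mathcal P^k_n$ with $y^l_i(\tau)=\tau x^l_i(\tau)$ for all $i,l$. *)

theory Defs
  imports "HOL-Probability.Probability"
begin

datatype benchmark = Proph | ExAnte

text \<open>
  A type distribution for \<open>n\<close> agents is a pair \<open>(m, G)\<close>, where \<open>G i j\<close> is meaningful for
  \<open>1 \<le> i \<le> n\<close> and \<open>0 \<le> j \<le> m\<close> only; no definition below depends on the other values of \<open>G\<close>.
\<close>

definition type_dist :: "nat \<Rightarrow> nat \<Rightarrow> (nat \<Rightarrow> nat \<Rightarrow> real) \<Rightarrow> bool" where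
  "type_dist n m G \<longleftrightarrow> m \<ge> 1 \<and>
     (\<forall>i\<in>{1..n}. G i 0 = 0 \<and> G i m = 1 \<and> (\<forall>j\<in>{1..m}. G i (j - 1) \<le> G i j))"

definition iid_type_dists :: "nat \<Rightarrow> (nat \<times> (nat \<Rightarrow> nat \<Rightarrow> real)) set" where
  "iid_type_dists n =
     {(m, G). type_dist n m G \<and> (\<forall>i\<in>{1..n}. \<forall>j\<in>{0..m}. G i j = G 1 j)}"

text \<open>
  An array indexed by \<open>[n] \<times> [k]\<close> is a function \<open>x i l\<close> that is \<open>0\<close> outside the index range.
  This makes equality of functions coincide with equality of arrays, and it also provides
  the convention \<open>y i (k + 1) = 0\<close> used in the last constraint.
\<close>

type_synonym state_array = "nat \<Rightarrow> nat \<Rightarrow> real"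

definition P_set :: "nat \<Rightarrow> nat \<Rightarrow> (state_array \<times> state_array) set" where
  "P_set k n = {(x, y).
     (\<forall>i l. (i, l) \<notin> {1..n} \<times> {1..k} \<longrightarrow> x i l = 0 \<and> y i l = 0) \<and>
     (\<forall>i\<in>{1..n}. \<forall>l\<in>{1..k}. 0 \<le> y i l \<and> y i l \<le> x i l) \<and>
     x 1 k = 1 \<and> (\<forall>l\<in>{1..<k}. x 1 l = 0) \<and>
     (\<forall>i\<in>{2..n}. \<forall>l\<in>{1..k}. x i l = x (i - 1) l - y (i - 1) l + y (i - 1) (l + 1))}"

definition follows_thresholds ::
  "nat \<Rightarrow> nat \<Rightarrow> (nat \<Rightarrow> real) \<Rightarrow> state_array \<Rightarrow> state_array \<Rightarrow> bool" where
  "follows_thresholds k n t x y \<longleftrightarrow> (\<forall>i\<in>{1..n}. \<forall>l\<in>{1..k}. y i l = t i * x i l)"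

definition threshold_policy ::
  "nat \<Rightarrow> nat \<Rightarrow> (nat \<Rightarrow> real) \<Rightarrow> state_array \<times> state_array" where
  "threshold_policy k n t =
     (THE p. p \<in> P_set k n \<and> follows_thresholds k n t (fst p) (snd p))"

text \<open>
  Thresholds in \<open>[0, 1]\<close> determine exactly one element of \<^const>\<open>P_set\<close>, so the
  definite description above is proper.
\<close>

lemma ex1_threshold_policy:
  assumes "k \<ge> 1" "n \<ge> 1" and t: "\<And>i. i \<in> {1..n} \<Longrightarrow> 0 \<le> t i \<and> t i \<le> 1"
  shows "\<exists>!p. p \<in> P_set k n \<and> follows_thresholds k n t (fst p) (snd p)"
proof -
  define X where "X = rec_nat (\<lambda>l. if l = k then 1 else (0::real))
    (\<lambda>i f l. if l \<in> {1..k} then f l - t (Suc i) * f l + t (Suc i) * f (Suc l) else 0)"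
  have X0: "X 0 l = (if l = k then 1 else 0)" for l by (simp add: X_def)
  have XS: "X (Suc i) l = (if l \<in> {1..k}
      then X i l - t (Suc i) * X i l + t (Suc i) * X i (Suc l) else 0)" for i l
    by (simp add: X_def)
  have out: "X i l = 0" if "l \<notin> {1..k}" for i l
    using that \<open>k \<ge> 1\<close> by (cases i) (auto simp: X0 XS)
  have nonneg: "0 \<le> X i l" if "i < n" for i l
    using that
  proof (induction i arbitrary: l)
    case (Suc i)
    then have "0 \<le> X i l" "0 \<le> X i (Suc l)" "0 \<le> t (Suc i)" "t (Suc i) \<le> 1"
      using t[of "Suc i"] by auto
    then have "0 \<le> (1 - t (Suc i)) * X i l + t (Suc i) * X i (Suc l)" by simp
    then show ?case by (simp add: XS algebra_simps)
  qed (simp add: X0)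
  define x where "x i l = (if i \<in> {1..n} then X (i - 1) l else 0)" for i l
  define y where "y i l = t i * x i l" for i l
  have "(x, y) \<in> P_set k n"
  proof -
    have 1: "\<forall>i l. (i, l) \<notin> {1..n} \<times> {1..k} \<longrightarrow> x i l = 0 \<and> y i l = 0"
      unfolding x_def y_def using out by auto
    have 2: "\<forall>i\<in>{1..n}. \<forall>l\<in>{1..k}. 0 \<le> y i l \<and> y i l \<le> x i l"
    proof (intro ballI)
      fix i l assume i: "i \<in> {1..n}" and "l \<in> {1..k}"
      then have "0 \<le> x i l" using nonneg[of "i - 1" l] by (auto simp: x_def)
      then show "0 \<le> y i l \<and> y i l \<le> x i l"
        using t[OF i] by (simp add: y_def mult_left_le_one_le)
    qed
    have 3: "x i l = x (i - 1) l - y (i - 1) l + y (i - 1) (l + 1)"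
      if "i \<in> {2..n}" "l \<in> {1..k}" for i l
    proof -
      from that obtain i' where i': "i = Suc (Suc i')"
        by (metis atLeastAtMost_iff Suc_le_D numeral_2_eq_2 Suc_le_mono)
      then show ?thesis using that by (auto simp: x_def y_def XS)
    qed
    show ?thesis unfolding P_set_def
      using 1 2 3 \<open>n \<ge> 1\<close> by (auto simp: x_def X0)
  qed
  moreover have "follows_thresholds k n t x y" by (simp add: follows_thresholds_def y_def)
  moreover have "p = p'"
    if p: "p \<in> P_set k n" "follows_thresholds k n t (fst p) (snd p)"
    and p': "p' \<in> P_set k n" "follows_thresholds k n t (fst p') (snd p')" for p p'
  proof -
    obtain a b a' b' where eq: "p = (a, b)" "p' = (a', b')" by (metis surj_pair)
    have b: "b i l = t i * a i l" "b' i l = t i * a' i l" for i l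
      using p p' unfolding eq P_set_def follows_thresholds_def
      by (cases "(i, l) \<in> {1..n} \<times> {1..k}"; auto)+
    have out: "a i l = 0 \<and> a' i l = 0" if "(i, l) \<notin> {1..n} \<times> {1..k}" for i l
      using that p p' unfolding eq P_set_def by blast
    have "a (Suc i) l = a' (Suc i) l" for i l
    proof (induction i arbitrary: l)
      case 0
      show ?case
      proof (cases "l \<in> {1..k}")
        case True
        then show ?thesis using p p' unfolding eq P_set_def by (cases "l = k") auto
      qed (use out in auto)
    next
      case (Suc i)
      show ?case
      proof (cases "(Suc (Suc i), l) \<in> {1..n} \<times> {1..k}")
        case True
        then have "a (Suc (Suc i)) l = a (Suc i) l - b (Suc i) l + b (Suc i) (l + 1)"
          "a' (Suc (Suc i)) l = a' (Suc i) l - b' (Suc i) l + b' (Suc i) (l + 1)"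
          using p p' unfolding eq P_set_def by auto
        then show ?thesis by (simp add: b Suc)
      qed (use out in auto)
    qed
    moreover have "a 0 l = a' 0 l" for l using out by simp
    ultimately have "a = a'" by (intro ext) (metis not0_implies_Suc)
    moreover from this b have "b = b'" by (intro ext) simp
    ultimately show ?thesis by (simp add: eq)
  qed
  ultimately show ?thesis by (intro ex_ex1I) (auto intro!: exI[of _ "(x, y)"])
qed

definition collected ::
  "nat \<Rightarrow> nat \<Rightarrow> (nat \<Rightarrow> real) \<Rightarrow> state_array \<times> state_array \<Rightarrow> real" where
  "collected k n q p = (\<Sum>i = 1..n. \<Sum>l = 1..k. min (snd p i l) (q i * fst p i l))"


subsection \<open>Inner problems\<close>

fun Q_inner :: "benchmark \<Rightarrow> nat \<Rightarrow> nat \<Rightarrow> (nat \<Rightarrow> nat \<Rightarrow> real) \<Rightarrow> nat \<Rightarrow> real" where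
  "Q_inner Proph k n G j =
     measure_pmf.expectation (Pi_pmf {1..n} False (\<lambda>i. bernoulli_pmf (G i j)))
       (\<lambda>X. min (\<Sum>i = 1..n. of_bool (X i)) (real k))"
| "Q_inner ExAnte k n G j = min (\<Sum>i = 1..n. G i j) (real k)"

definition interpolated :: "(nat \<Rightarrow> nat \<Rightarrow> real) \<Rightarrow> nat \<Rightarrow> real \<Rightarrow> nat \<Rightarrow> real" where
  "interpolated G J \<rho> i = (1 - \<rho>) * G i (J - 1) + \<rho> * G i J"

text \<open>
  Optimal values are suprema in the extended reals, so no boundedness or nonemptiness of the
  sets of feasible \<open>\<theta>\<close> is built in.
\<close>

definition innerLP_DP ::
  "benchmark \<Rightarrow> nat \<Rightarrow> nat \<Rightarrow> nat \<Rightarrow> (nat \<Rightarrow> nat \<Rightarrow> real) \<Rightarrow> ereal" where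
  "innerLP_DP b k n m G = Sup {ereal \<theta> | \<theta> x y. (x, y) \<in> P_set k n \<and>
     (\<forall>j\<in>{1..m}. \<theta> * Q_inner b k n G j \<le> collected k n (\<lambda>i. G i j) (x, y))}"

definition innerLP_OST ::
  "nat \<Rightarrow> real \<Rightarrow> benchmark \<Rightarrow> nat \<Rightarrow> nat \<Rightarrow> nat \<Rightarrow> (nat \<Rightarrow> nat \<Rightarrow> real) \<Rightarrow> ereal" where
  "innerLP_OST J \<rho> b k n m G = Sup {ereal \<theta> | \<theta> x y. (x, y) \<in> P_set k n \<and>
     (\<forall>j\<in>{1..m}. \<theta> * Q_inner b k n G j \<le> collected k n (\<lambda>i. G i j) (x, y)) \<and>
     follows_thresholds k n (interpolated G J \<rho>) x y}"

definition innerLP_ST ::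
  "benchmark \<Rightarrow> nat \<Rightarrow> nat \<Rightarrow> nat \<Rightarrow> (nat \<Rightarrow> nat \<Rightarrow> real) \<Rightarrow> ereal" where
  "innerLP_ST b k n m G = Sup {ereal \<theta> | \<theta> \<mu>. prob_space \<mu> \<and>
     sets \<mu> = sets (count_space {1..m} \<Otimes>\<^sub>M restrict_space borel {0<..1::real}) \<and>
     (\<forall>j\<in>{1..m}. \<theta> * Q_inner b k n G j \<le>
        (\<integral>(J, \<rho>). collected k n (\<lambda>i. G i j) (threshold_policy k n (interpolated G J \<rho>)) \<partial>\<mu>))}"


subsection \<open>Semi-infinite problems for identically distributed agents\<close>

fun Q_iid :: "benchmark \<Rightarrow> nat \<Rightarrow> nat \<Rightarrow> real \<Rightarrow> real" where
  "Q_iid Proph k n q = measure_pmf.expectation (binomial_pmf n q) (\<lambda>s. min (real s) (real k))"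
| "Q_iid ExAnte k n q = min (real n * q) (real k)"

definition iidLP_DP :: "benchmark \<Rightarrow> nat \<Rightarrow> nat \<Rightarrow> ereal" where
  "iidLP_DP b k n = Sup {ereal \<theta> | \<theta> x y. (x, y) \<in> P_set k n \<and>
     (\<forall>q\<in>{0<..1}. \<theta> * Q_iid b k n q \<le> collected k n (\<lambda>_. q) (x, y))}"

definition iidLP_OST :: "real \<Rightarrow> benchmark \<Rightarrow> nat \<Rightarrow> nat \<Rightarrow> ereal" where
  "iidLP_OST \<tau> b k n = Sup {ereal \<theta> | \<theta> x y. (x, y) \<in> P_set k n \<and>
     (\<forall>q\<in>{0<..1}. \<theta> * Q_iid b k n q \<le> collected k n (\<lambda>_. q) (x, y)) \<and>
     follows_thresholds k n (\<lambda>_. \<tau>) x y}"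

definition iidLP_ST :: "benchmark \<Rightarrow> nat \<Rightarrow> nat \<Rightarrow> ereal" where
  "iidLP_ST b k n = Sup {ereal \<theta> | \<theta> \<mu>. prob_space \<mu> \<and>
     sets \<mu> = sets (restrict_space borel {0<..1::real}) \<and>
     (\<forall>q\<in>{0<..1}. \<theta> * Q_iid b k n q \<le>
        (\<integral>\<tau>. collected k n (\<lambda>_. q) (threshold_policy k n (\<lambda>_. \<tau>)) \<partial>\<mu>))}"

end

theory Submission
  imports Defs
begin

text \<open>
  For identically distributed agents the inner constraint for type \<open>j\<close> is the semi-infinite
  constraint at \<open>q = G 1 j\<close>, so every inner value is at least the semi-infinite one; thresholds
  \<open>\<tau> \<in> (0, 1]\<close> and pairs \<open>(J, \<rho>)\<close> are matched by interpolation, and distributions over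
  them by push-forward. Conversely take the geometric grid \<open>r ^ (m - j)\<close>. The reward \<open>C\<close>
  satisfies \<open>c * C q \<le> C (c * q)\<close> for \<open>c \<in> [0, 1]\<close>, and \<open>Q\<close> is nondecreasing, hence passing from
  a grid point to any \<open>q\<close> in the cell below it costs at most a factor \<open>r\<close>. Below the smallest
  grid point the bounds \<open>n q / (1 + n q) \<le> Q q \<le> n q\<close> give the same factor once \<open>m\<close> is large.
  So \<open>\<theta>\<close> feasible on the grid makes \<open>r * \<theta>\<close> feasible for all \<open>q\<close>, and \<open>r\<close> tends to 1.
\<close>

section \<open>Binomial expectations and bounds on the benchmarks \<open>Q\<close>\<close>

text \<open>Conditioning on one trial; this is the induction step for the mean and for monotonicity
  in \<open>p\<close>.\<close>

lemma expectation_binomial_pmf_Suc: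
  fixes f :: "nat \<Rightarrow> real"
  assumes "0 \<le> p" "p \<le> 1"
  shows "measure_pmf.expectation (binomial_pmf (Suc n) p) f =
    p * measure_pmf.expectation (binomial_pmf n p) (\<lambda>s. f (Suc s)) +
    (1 - p) * measure_pmf.expectation (binomial_pmf n p) f"
proof -
  have "binomial_pmf (Suc n) p =
      bernoulli_pmf p \<bind> (\<lambda>b. map_pmf (\<lambda>s. (if b then 1 else 0) + s) (binomial_pmf n p))"
    using assms by (simp add: binomial_pmf_Suc map_pmf_def)
  moreover have "finite (set_pmf (binomial_pmf n p))" using assms by auto
  ultimately have "measure_pmf.expectation (binomial_pmf (Suc n) p) f =
    (\<Sum>b\<in>UNIV. pmf (bernoulli_pmf p) b *\<^sub>R
      measure_pmf.expectation (map_pmf (\<lambda>s. (if b then 1 else 0) + s) (binomial_pmf n p)) f)"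
    by (simp only:) (rule pmf_expectation_bind, simp_all)
  then show ?thesis using assms by (simp add: UNIV_bool)
qed

lemma expectation_binomial_pmf_id:
  assumes "0 \<le> p" "p \<le> 1"
  shows "measure_pmf.expectation (binomial_pmf n p) real = n * p"
proof (induction n)
  case 0
  then show ?case using assms by (simp add: binomial_pmf_0)
next
  case (Suc n)
  have "integrable (binomial_pmf n p) real" using assms by simp
  then have "measure_pmf.expectation (binomial_pmf n p) (\<lambda>s. real (Suc s)) = n * p + 1"
    by (simp add: Suc)
  then show ?case
    using assms by (simp add: expectation_binomial_pmf_Suc Suc algebra_simps)
qed

text \<open>Induction on the number of trials, with \<open>f\<close> general because conditioning on
  a trial produces both \<open>f\<close> and its shift, which is again monotone.\<close>

lemma expectation_binomial_pmf_mono: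
  fixes f :: "nat \<Rightarrow> real"
  assumes "0 \<le> p" "p \<le> q" "q \<le> 1" "mono f"
  shows "measure_pmf.expectation (binomial_pmf n p) f
    \<le> measure_pmf.expectation (binomial_pmf n q) f"
  using \<open>mono f\<close>
proof (induction n arbitrary: f)
  case 0
  then show ?case using assms by (simp add: binomial_pmf_0)
next
  case (Suc n)
  let ?E = "\<lambda>r. measure_pmf.expectation (binomial_pmf n r)"
  let ?g = "\<lambda>s. f (Suc s)"
  have "mono ?g" using Suc.prems by (simp add: mono_def)
  then have A: "?E p ?g \<le> ?E q ?g" and B: "?E p f \<le> ?E q f" using Suc by auto
  have C: "?E p f \<le> ?E p ?g"
    using assms Suc.prems by (intro integral_mono) (auto simp: mono_def)
  \<comment> \<open>The success probability of the separated trial is raised to \<open>q\<close>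
    first: here it multiplies an increment that is nonnegative by \<open>C\<close>. The inner
    expectations are raised afterwards.\<close>
  have "p * ?E p ?g + (1 - p) * ?E p f = ?E p f + p * (?E p ?g - ?E p f)"
    by (simp add: algebra_simps)
  also have "\<dots> \<le> ?E p f + q * (?E p ?g - ?E p f)"
    using assms C by (intro add_left_mono mult_right_mono) auto
  also have "\<dots> = q * ?E p ?g + (1 - q) * ?E p f" by (simp add: algebra_simps)
  also have "\<dots> \<le> q * ?E q ?g + (1 - q) * ?E q f"
    using assms A B by (intro add_mono mult_left_mono) auto
  finally show ?case using assms by (simp add: expectation_binomial_pmf_Suc)
qed

lemma Q_iid_mono:
  assumes "0 \<le> p" "p \<le> q" "q \<le> 1"
  shows "Q_iid b k n p \<le> Q_iid b k n q"
proof (cases b)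
  case Proph
  have "mono (\<lambda>s. min (real s) (real k))" by (auto simp: mono_def)
  from expectation_binomial_pmf_mono[OF assms this] show ?thesis by (simp add: Proph)
next
  case ExAnte
  have "n * p \<le> n * q" using assms by (intro mult_left_mono) auto
  then show ?thesis by (simp add: ExAnte)
qed

lemma Q_iid_le:
  assumes "0 \<le> q" "q \<le> 1"
  shows "Q_iid b k n q \<le> n * q"
proof (cases b)
  case Proph
  have "measure_pmf.expectation (binomial_pmf n q) (\<lambda>s. min (real s) (real k))
      \<le> measure_pmf.expectation (binomial_pmf n q) real"
    using assms by (intro integral_mono) auto
  then show ?thesis using assms by (simp add: Proph expectation_binomial_pmf_id)
qed simp

text \<open>Together with \<open>Q_iid_le\<close> this makes \<open>Q\<close> linear near 0 up to
  the factor \<open>1 + n * q\<close>. For \<open>Proph\<close>, truncation at \<open>k\<close>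
  leaves at least the probability of one success, \<open>1 - (1 - q) ^ n\<close>; for
  \<open>ExAnte\<close>, \<open>u / (1 + u)\<close> is below both \<open>u\<close> and 1.\<close>

lemma Q_iid_ge:
  assumes "0 \<le> q" "q \<le> 1" "k \<ge> 1"
  shows "n * q / (1 + n * q) \<le> Q_iid b k n q"
proof (cases b)
  case Proph
  \<comment> \<open>Bernoulli's inequality replaces \<open>1 + n * q\<close> by a power that
    combines with \<open>(1 - q) ^ n\<close> to a power of a number in [0, 1].\<close>
  have "(1 - q) ^ n * (1 + n * q) \<le> (1 - q) ^ n * (1 + q) ^ n"
    using assms Bernoulli_inequality[of q n] by (intro mult_left_mono) auto
  also have "\<dots> = (1 - q\<^sup>2) ^ n"
    by (simp add: power_mult_distrib[symmetric] power2_eq_square algebra_simps)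
  also have "\<dots> \<le> 1" using assms by (intro power_le_one) (auto simp: power_le_one)
  finally have "(1 - q) ^ n * (1 + n * q) \<le> 1" .
  moreover have pos: "0 < 1 + n * q" using assms by (simp add: add_pos_nonneg)
  ultimately have "n * q / (1 + n * q) \<le> 1 - (1 - q) ^ n"
    by (simp add: divide_simps algebra_simps)
  also have "\<dots> = measure_pmf.expectation (binomial_pmf n q) (\<lambda>s. 1 - indicat_real {0} s)"
    using assms by (subst Bochner_Integration.integral_diff) (auto simp: measure_pmf_single)
  also have "\<dots> \<le> measure_pmf.expectation (binomial_pmf n q) (\<lambda>s. min (real s) (real k))"
    using assms by (intro integral_mono) (auto simp: indicator_def)
  finally show ?thesis by (simp add: Proph)
next
  case ExAnte
  have "0 \<le> n * q" using assms by simp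
  moreover have "u / (1 + u) \<le> u" "u / (1 + u) \<le> 1" if "0 \<le> u" for u :: real
    using that by (auto simp: divide_simps algebra_simps)
  ultimately have "n * q / (1 + n * q) \<le> n * q" "n * q / (1 + n * q) \<le> 1" by blast+
  then show ?thesis using assms by (simp add: ExAnte)
qed

text \<open>Needed for types with \<open>G 1 j = 0\<close>, which lie outside the range (0, 1] of
  the semi-infinite constraints.\<close>

lemma Q_iid_0 [simp]: "Q_iid b k n 0 = 0"
proof -
  have "Q_iid b k n 0 \<le> 0" using Q_iid_le[of 0 b k n] by simp
  moreover have "0 \<le> Q_iid b k n 0"
    by (cases b) (auto intro!: integral_nonneg_AE)
  ultimately show ?thesis by simp
qed

text \<open>The number of successes among independent, identically distributed Bernoulli variables
  is binomial.\<close>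

lemma Q_inner_eq_Q_iid:
  assumes "\<And>i. i \<in> {1..n} \<Longrightarrow> G i j = q" "0 \<le> q" "q \<le> 1"
  shows "Q_inner b k n G j = Q_iid b k n q"
proof (cases b)
  case Proph
  have "Pi_pmf {1..n} False (\<lambda>i. bernoulli_pmf (G i j))
      = Pi_pmf {1..n} False (\<lambda>_. bernoulli_pmf q)"
    using assms by (intro Pi_pmf_cong) auto
  moreover have "binomial_pmf n q =
      map_pmf (\<lambda>f. card {x\<in>{1..n}. f x}) (Pi_pmf {1..n} False (\<lambda>_. bernoulli_pmf q))"
    using assms by (intro binomial_pmf_altdef') auto
  moreover have "(\<Sum>i = 1..n. of_bool (X i)) = real (card {i\<in>{1..n}. X i})" for X
    by (simp add: of_bool_def sum.If_cases Int_def)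
  ultimately show ?thesis by (simp add: Proph)
next
  case ExAnte
  then show ?thesis using assms by simp
qed

section \<open>The geometric grid and the loss of a factor \<open>r\<close>\<close>

text \<open>The value at index 0 is forced by \<open>type_dist\<close>; hence the smallest positive
  grid point is \<open>r ^ (m - 1)\<close>, and neighbouring positive points have ratio
  \<open>r\<close>.\<close>

definition geometric_grid :: "real \<Rightarrow> nat \<Rightarrow> nat \<Rightarrow> nat \<Rightarrow> real" where
  "geometric_grid r m i j = (if j = 0 then 0 else r ^ (m - j))"

lemma geometric_grid_iid:
  assumes "0 < r" "r < 1" "m \<ge> 1"
  shows "(m, geometric_grid r m) \<in> iid_type_dists n"
  using assms
  by (auto simp: iid_type_dists_def type_dist_def geometric_grid_def intro!: power_decreasing)

lemma iid_type_distsD: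
  assumes "(m, G) \<in> iid_type_dists n" "n \<ge> 1"
  shows "m \<ge> 1" "G 1 0 = 0" "G 1 m = 1"
    and "\<And>i j. i \<in> {1..n} \<Longrightarrow> j \<le> m \<Longrightarrow> G i j = G 1 j"
    and "\<And>i j. i \<le> j \<Longrightarrow> j \<le> m \<Longrightarrow> G 1 i \<le> G 1 j"
    and "\<And>j. j \<le> m \<Longrightarrow> G 1 j \<in> {0..1}"
proof -
  have td: "type_dist n m G" and iid: "\<forall>i\<in>{1..n}. \<forall>j\<in>{0..m}. G i j = G 1 j"
    using assms(1) by (auto simp only: iid_type_dists_def mem_Collect_eq split_conv)
  show "m \<ge> 1" "G 1 0 = 0" "G 1 m = 1"
    using td assms(2) by (auto simp: type_dist_def)
  show "G i j = G 1 j" if "i \<in> {1..n}" "j \<le> m" for i j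
    using iid that by (metis atLeastAtMost_iff zero_le)
  have inc: "G 1 (j - 1) \<le> G 1 j" if "j \<in> {1..m}" for j
    using td assms(2) that by (auto simp: type_dist_def)
  show mono: "G 1 i \<le> G 1 j" if "i \<le> j" "j \<le> m" for i j
    using that
  proof (induction j rule: dec_induct)
    case (step j)
    then show ?case using inc[of "Suc j"] by auto
  qed simp
  show "G 1 j \<in> {0..1}" if "j \<le> m" for j
    using mono[of 0 j] mono[of j m] that \<open>G 1 0 = 0\<close> \<open>G 1 m = 1\<close> by simp
qed

text \<open>\<open>C\<close> is abstract so that it can be the reward of one fixed policy as well as
  the average reward of a random threshold; both satisfy the inequality
  \<open>scale\<close>.\<close>

lemma geometric_grid_feasible:
  fixes Q C :: "real \<Rightarrow> real"
  assumes r: "0 < r" "r < 1"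
    and m: "m \<ge> 1" "r ^ (m - 1) * n \<le> 1 - r" and k: "k \<ge> 1" "n \<ge> 1"
    and scale: "\<And>c q. 0 \<le> c \<Longrightarrow> c \<le> 1 \<Longrightarrow> 0 \<le> q \<Longrightarrow> q \<le> 1 \<Longrightarrow> c * C q \<le> C (c * q)"
    and \<theta>: "0 \<le> \<theta>" "\<And>j. j \<in> {1..m} \<Longrightarrow> \<theta> * Q_iid b k n (r ^ (m - j)) \<le> C (r ^ (m - j))"
    and q: "q \<in> {0<..1}"
  shows "r * \<theta> * Q_iid b k n q \<le> C q"
proof (cases "q \<le> r ^ (m - 1)")
  case True
  let ?p = "r ^ (m - 1)"
  have p: "0 < ?p" "?p \<le> 1" using r by (auto intro: power_le_one)
  have np: "0 < n * ?p" using k p by simp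
  \<comment> \<open>The choice of \<open>m\<close> bounds \<open>n * ?p\<close> by
    \<open>1 - r\<close>, and \<open>r * (2 - r) \<le> 1\<close>; so the factor
    \<open>1 / (1 + n * ?p)\<close> in the lower bound at \<open>?p\<close> is at least
    \<open>r\<close>.\<close>
  have "r * (1 + n * ?p) \<le> r * (1 + (1 - r))"
    using r m by (intro mult_left_mono) (auto simp: mult.commute)
  also have "\<dots> = 1 - (1 - r)\<^sup>2" by (simp add: power2_eq_square algebra_simps)
  also have "\<dots> \<le> 1" by simp
  finally have "r \<le> 1 / (1 + n * ?p)" using np by (simp add: field_simps)
  then have "r * (n * ?p) \<le> 1 / (1 + n * ?p) * (n * ?p)"
    using np by (intro mult_right_mono) auto
  also have "\<dots> \<le> Q_iid b k n ?p" using Q_iid_ge[of ?p k n b] p k by simp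
  finally have rn: "r * (n * ?p) \<le> Q_iid b k n ?p" .
  \<comment> \<open>The linear upper bound at \<open>q\<close> is compared with the lower bound at
    \<open>?p\<close>. Their ratio \<open>q / ?p\<close> is exactly the factor by which
    \<open>C\<close> is then scaled from \<open>?p\<close> down to \<open>q\<close>.\<close>
  have "r * \<theta> * Q_iid b k n q \<le> r * \<theta> * (n * q)"
    using Q_iid_le[of q b k n] q r \<theta> by (intro mult_left_mono) auto
  also have "\<dots> = \<theta> * (q / ?p) * (r * (n * ?p))" using p by (simp add: field_simps)
  also have "\<dots> \<le> \<theta> * (q / ?p) * Q_iid b k n ?p"
    using rn p q \<theta> by (intro mult_left_mono) auto
  also have "\<dots> = q / ?p * (\<theta> * Q_iid b k n ?p)" by simp
  also have "\<dots> \<le> q / ?p * C ?p"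
    using \<theta>(2)[of 1] m q p by (intro mult_left_mono) auto
  also have "\<dots> \<le> C (q / ?p * ?p)"
    using q p True by (intro scale) (auto simp: divide_simps)
  also have "q / ?p * ?p = q" using r by simp
  finally show ?thesis .
next
  case False
  \<comment> \<open>The smallest grid point that is at least \<open>q\<close>. The formula gives
    \<open>r ^ m\<close> instead of 0 at index 0, but the case assumption forces
    \<open>j > 1\<close>, so \<open>j\<close> and \<open>j - 1\<close> both index positive grid
    points.\<close>
  define j where "j = (LEAST j. q \<le> r ^ (m - j))"
  have ex: "q \<le> r ^ (m - m)" using q by simp
  have qj: "q \<le> r ^ (m - j)" unfolding j_def using ex by (rule LeastI)
  have jm: "j \<le> m" unfolding j_def using ex by (rule Least_le)
  have j1: "j > 1"
  proof (rule ccontr)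
    assume "\<not> j > 1"
    then have "r ^ (m - j) \<le> r ^ (m - 1)" using r by (intro power_decreasing) auto
    then show False using qj False by simp
  qed
  let ?p = "r ^ (m - j)"
  have p: "0 < ?p" "?p \<le> 1" using r by (auto intro: power_le_one)
  \<comment> \<open>By minimality the next lower grid point \<open>r * ?p\<close> is below
    \<open>q\<close>, so \<open>r\<close> is at most the scaling factor
    \<open>q / ?p\<close>.\<close>
  have "\<not> q \<le> r ^ (m - (j - 1))"
    using j1 unfolding j_def by (intro not_less_Least) auto
  moreover have "m - (j - 1) = Suc (m - j)" using j1 jm by auto
  then have "r ^ (m - (j - 1)) = r * ?p" by simp
  ultimately have rq: "r * ?p < q" by linarith
  have "0 \<le> Q_iid b k n ?p" using Q_iid_mono[of 0 ?p b k n] p by simp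
  moreover have "r \<le> q / ?p" using rq p by (simp add: field_simps)
  ultimately have "r * (\<theta> * Q_iid b k n ?p) \<le> q / ?p * (\<theta> * Q_iid b k n ?p)"
    using \<theta> by (intro mult_right_mono) auto
  moreover have "r * (\<theta> * Q_iid b k n q) \<le> r * (\<theta> * Q_iid b k n ?p)"
    using Q_iid_mono[of q ?p b k n] q qj p r \<theta> by (intro mult_left_mono) auto
  moreover have "q / ?p * (\<theta> * Q_iid b k n ?p) \<le> q / ?p * C ?p"
    using \<theta>(2)[of j] j1 jm q p by (intro mult_left_mono) auto
  moreover have "q / ?p * C ?p \<le> C (q / ?p * ?p)"
    using q p qj by (intro scale) (auto simp: divide_simps)
  moreover have "q / ?p * ?p = q" using r by simp
  ultimately show ?thesis by (simp only: mult.assoc)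
qed

lemma ex_geometric_grid:
  fixes r :: real and n :: nat
  assumes "0 < r" "r < 1"
  shows "\<exists>m\<ge>1. r ^ (m - 1) * n \<le> 1 - r"
proof -
  have "(\<lambda>m. r ^ m * n) \<longlonglongrightarrow> 0 * real n"
    using assms by (intro tendsto_mult LIMSEQ_power_zero tendsto_const) auto
  then have "\<forall>\<^sub>F m in sequentially. r ^ m * n < 1 - r"
    using assms by (intro order_tendstoD(2)[where y = 0]) auto
  then obtain m where "r ^ m * n < 1 - r" by (auto simp: eventually_sequentially)
  then show ?thesis by (intro exI[of _ "Suc m"]) auto
qed

text \<open>The limit \<open>r\<close> to 1 in the extended reals; for infinite \<open>L\<close>
  there is nothing to show.\<close>

lemma INF_le_if_scaled:
  fixes F :: "'a \<Rightarrow> ereal"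
  assumes "0 \<le> L"
    and "\<And>r. 0 < r \<Longrightarrow> r < 1 \<Longrightarrow> \<exists>a\<in>A. F a \<le> L / ereal r"
  shows "(INF a\<in>A. F a) \<le> L"
proof (rule ereal_le_epsilon2)
  fix e :: real assume "0 < e"
  show "(INF a\<in>A. F a) \<le> L + ereal e"
  proof (cases L)
    case (real l)
    \<comment> \<open>Close enough to 1 that \<open>l / r \<le> l + e\<close>; the summand
      \<open>e / 2\<close> keeps \<open>r\<close> positive when \<open>l = 0\<close>.\<close>
    define r where "r = (l + e / 2) / (l + e)"
    have l: "0 \<le> l" using assms real by simp
    then have r: "0 < r" "r < 1" using \<open>0 < e\<close> by (auto simp: r_def divide_simps)
    then obtain a where a: "a \<in> A" "F a \<le> L / ereal r" using assms(2) by blast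
    have "l \<le> l + e / 2" using \<open>0 < e\<close> by simp
    also have "\<dots> = (l + e) * r" using l \<open>0 < e\<close> by (simp add: r_def)
    finally have "l / r \<le> l + e" using r by (simp add: field_simps)
    then have "L / ereal r \<le> L + ereal e" using r by (simp add: real)
    then show ?thesis using a by (meson INF_lower2 order_trans)
  qed (use assms in auto)
qed

section \<open>Bounds on policies and on the collected reward\<close>

text \<open>The bounds hold at all indices since arrays vanish outside their range. The bound
  \<open>2 ^ i\<close> is crude, but uniform over all policies, as integrability later requires; it
  follows from \<open>x (i + 1) l \<le> x i l + x i (l + 1)\<close>.\<close>

lemma P_set_bounds:
  assumes "(x, y) \<in> P_set k n"
  shows "0 \<le> x i l" "0 \<le> y i l" "y i l \<le> x i l" "x i l \<le> 2 ^ i"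
proof -
  have in_range: "0 \<le> y i l \<and> y i l \<le> x i l" if "(i, l) \<in> {1..n} \<times> {1..k}" for i l
    using assms that unfolding P_set_def by auto
  have out: "x i l = 0 \<and> y i l = 0" if "(i, l) \<notin> {1..n} \<times> {1..k}" for i l
    using assms that unfolding P_set_def by auto
  have y: "0 \<le> y i l \<and> y i l \<le> x i l" for i l
    using in_range[of i l] out[of i l] by (cases "(i, l) \<in> {1..n} \<times> {1..k}") auto
  then show "0 \<le> x i l" "0 \<le> y i l" "y i l \<le> x i l" by (auto intro: order_trans)
  show "x i l \<le> 2 ^ i"
  proof (induction i arbitrary: l)
    case 0
    then show ?case using out[of 0 l] by simp
  next
    case (Suc i)
    show ?case
    proof (cases "(Suc i, l) \<in> {1..n} \<times> {1..k}")
      case False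
      then show ?thesis using out by simp
    next
      case range: True
      show ?thesis
      proof (cases "i = 0")
        case True
        then have "x (Suc i) l \<le> 1"
          using assms range unfolding P_set_def by (cases "l = k") auto
        then show ?thesis by (simp add: True)
      next
        case False
        then have "x (Suc i) l = x i l - y i l + y i (l + 1)"
          using assms range unfolding P_set_def by auto
        also have "\<dots> \<le> x i l + x i (l + 1)" using y[of i l] y[of i "l + 1"] by simp
        also have "\<dots> \<le> 2 ^ Suc i" using Suc[of l] Suc[of "l + 1"] by simp
        finally show ?thesis .
      qed
    qed
  qed
qed

lemma collected_cong:
  assumes "\<And>i. i \<in> {1..n} \<Longrightarrow> q i = q' i"
  shows "collected k n q p = collected k n q' p"
  unfolding collected_def using assms by (intro sum.cong) auto

lemma collected_nonneg:
  assumes "p \<in> P_set k n" "0 \<le> q"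
  shows "0 \<le> collected k n (\<lambda>_. q) p"
  using assms P_set_bounds[of "fst p" "snd p" k n]
  by (auto simp: collected_def intro!: sum_nonneg)

lemma collected_0:
  assumes "p \<in> P_set k n"
  shows "collected k n (\<lambda>_. 0) p = 0"
  using assms P_set_bounds(2)[of "fst p" "snd p" k n]
  by (auto simp: collected_def min_def intro!: sum.neutral antisym)

text \<open>This provides the hypothesis \<open>scale\<close> of the grid argument. Distributing
  \<open>c\<close> over each minimum changes its first argument \<open>y\<close> to
  \<open>c * y\<close>, which is at most \<open>y\<close>.\<close>

lemma collected_scale:
  assumes "p \<in> P_set k n" "0 \<le> c" "c \<le> 1" "0 \<le> q"
  shows "c * collected k n (\<lambda>_. q) p \<le> collected k n (\<lambda>_. c * q) p"
  unfolding collected_def sum_distrib_left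
proof (intro sum_mono)
  fix i l
  have "0 \<le> snd p i l" using assms P_set_bounds(2)[of "fst p" "snd p"] by simp
  then have "c * snd p i l \<le> snd p i l" using assms by (simp add: mult_left_le_one_le)
  moreover have "c * min (snd p i l) (q * fst p i l) = min (c * snd p i l) (c * (q * fst p i l))"
    using assms by (simp add: min_mult_distrib_left)
  ultimately show "c * min (snd p i l) (q * fst p i l) \<le> min (snd p i l) (c * q * fst p i l)"
    by (simp add: mult.assoc min.coboundedI1)
qed

lemma collected_le:
  assumes "p \<in> P_set k n"
  shows "collected k n q p \<le> (\<Sum>i = 1..n. \<Sum>l = 1..k. 2 ^ i)"
  unfolding collected_def
proof (intro sum_mono)
  fix i l
  have "snd p i l \<le> 2 ^ i"
    using assms P_set_bounds(3,4)[of "fst p" "snd p" k n i l] by simp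
  then show "min (snd p i l) (q i * fst p i l) \<le> 2 ^ i" by simp
qed

section \<open>Threshold policies and their measurable dependence on the threshold\<close>

lemma threshold_policy_props:
  assumes "k \<ge> 1" "n \<ge> 1" "\<And>i. i \<in> {1..n} \<Longrightarrow> t i \<in> {0..1}"
  shows "threshold_policy k n t \<in> P_set k n"
    and "follows_thresholds k n t (fst (threshold_policy k n t)) (snd (threshold_policy k n t))"
proof -
  have "\<exists>!p. p \<in> P_set k n \<and> follows_thresholds k n t (fst p) (snd p)"
    using assms by (intro ex1_threshold_policy) auto
  from theI'[OF this]
  show "threshold_policy k n t \<in> P_set k n"
    and "follows_thresholds k n t (fst (threshold_policy k n t)) (snd (threshold_policy k n t))"
    unfolding threshold_policy_def by auto
qed

lemma follows_thresholds_cong: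
  assumes "\<And>i. i \<in> {1..n} \<Longrightarrow> t i = t' i"
  shows "follows_thresholds k n t = follows_thresholds k n t'"
  using assms by (simp add: follows_thresholds_def fun_eq_iff)

text \<open>The definite description hides how the policy depends on \<tau>. The recursion over
  agents shows that each entry is a polynomial in \<tau> on [0, 1], where existence and uniqueness
  are guaranteed.\<close>

lemma measurable_threshold_policy:
  assumes "k \<ge> 1" "n \<ge> 1"
  shows "(\<lambda>\<tau>. fst (threshold_policy k n (\<lambda>_. \<tau>)) i l) \<in> borel_measurable (restrict_space borel {0..1})"
    and "(\<lambda>\<tau>. snd (threshold_policy k n (\<lambda>_. \<tau>)) i l) \<in> borel_measurable (restrict_space borel {0..1})"
proof -
  define M where "M = restrict_space borel {0..1::real}"
  define x where "x \<tau> = fst (threshold_policy k n (\<lambda>_. \<tau>))" for \<tau>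
  define y where "y \<tau> = snd (threshold_policy k n (\<lambda>_. \<tau>))" for \<tau>
  have space: "space M = {0..1}" by (simp add: M_def)
  have id [measurable]: "(\<lambda>\<tau>. \<tau>) \<in> borel_measurable M"
    unfolding M_def by (intro measurable_restrict_space1) simp
  have P: "(x \<tau>, y \<tau>) \<in> P_set k n" "follows_thresholds k n (\<lambda>_. \<tau>) (x \<tau>) (y \<tau>)"
    if "\<tau> \<in> space M" for \<tau>
    using threshold_policy_props[of k n "\<lambda>_. \<tau>"] assms that by (auto simp: x_def y_def space)
  have out: "x \<tau> i l = 0" "y \<tau> i l = 0"
    if "(i, l) \<notin> {1..n} \<times> {1..k}" "\<tau> \<in> space M" for i l \<tau>
    using P(1)[OF that(2)] that(1) unfolding P_set_def by auto
  \<comment> \<open>Valid at all indices, both sides being 0 outside the range; the case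
    \<open>l = k + 1\<close> enters the recursion for \<open>x\<close>.\<close>
  have y_eq: "y \<tau> i l = \<tau> * x \<tau> i l" if "\<tau> \<in> space M" for i l \<tau>
    using P(2)[OF that] out[of i l \<tau>] that
    by (cases "(i, l) \<in> {1..n} \<times> {1..k}") (auto simp: follows_thresholds_def)
  have x_meas: "(\<lambda>\<tau>. x \<tau> i l) \<in> borel_measurable M" for i l
  proof (induction i arbitrary: l)
    case 0
    have "(\<lambda>\<tau>. x \<tau> 0 l) \<in> borel_measurable M \<longleftrightarrow> (\<lambda>_. 0::real) \<in> borel_measurable M"
      by (intro measurable_cong) (auto intro: out)
    then show ?case by simp
  next
    case (Suc i)
    note [measurable] = Suc
    \<comment> \<open>On the space, each entry equals an explicit expression in the entries of the
      preceding agent. Agent 1 is the case \<open>i = 0\<close>, with the prescribed initial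
      state.\<close>
    have "(\<lambda>\<tau>. x \<tau> (Suc i) l) \<in> borel_measurable M \<longleftrightarrow>
      (\<lambda>\<tau>. if (Suc i, l) \<notin> {1..n} \<times> {1..k} then 0 else if i = 0 then of_bool (l = k)
        else x \<tau> i l - \<tau> * x \<tau> i l + \<tau> * x \<tau> i (l + 1)) \<in> borel_measurable M"
    proof (intro measurable_cong)
      fix \<tau> assume \<tau>: "\<tau> \<in> space M"
      have "x \<tau> (Suc i) l = of_bool (l = k)" if "i = 0" "l \<in> {1..k}"
        using P(1)[OF \<tau>] that unfolding P_set_def by (cases "l = k") auto
      moreover have "x \<tau> (Suc i) l = x \<tau> i l - \<tau> * x \<tau> i l + \<tau> * x \<tau> i (l + 1)"
        if "i \<noteq> 0" "l \<in> {1..k}" "Suc i \<le> n"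
      proof -
        have "x \<tau> (Suc i) l = x \<tau> i l - y \<tau> i l + y \<tau> i (l + 1)"
          using P(1)[OF \<tau>] that unfolding P_set_def by auto
        then show ?thesis by (simp add: y_eq[OF \<tau>])
      qed
      ultimately show "x \<tau> (Suc i) l =
        (if (Suc i, l) \<notin> {1..n} \<times> {1..k} then 0 else if i = 0 then of_bool (l = k)
        else x \<tau> i l - \<tau> * x \<tau> i l + \<tau> * x \<tau> i (l + 1))"
        using out(1)[OF _ \<tau>, of "Suc i" l] by auto
    qed
    then show ?case by simp
  qed
  then show "(\<lambda>\<tau>. fst (threshold_policy k n (\<lambda>_. \<tau>)) i l)
    \<in> borel_measurable (restrict_space borel {0..1})"
    by (simp add: x_def M_def)
  have "(\<lambda>\<tau>. y \<tau> i l) \<in> borel_measurable M \<longleftrightarrow> (\<lambda>\<tau>. \<tau> * x \<tau> i l) \<in> borel_measurable M"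
    by (intro measurable_cong) (rule y_eq)
  moreover have "(\<lambda>\<tau>. \<tau> * x \<tau> i l) \<in> borel_measurable M"
    using x_meas[of i l] by measurable
  ultimately show "(\<lambda>\<tau>. snd (threshold_policy k n (\<lambda>_. \<tau>)) i l)
    \<in> borel_measurable (restrict_space borel {0..1})"
    by (simp add: y_def M_def)
qed

lemma measurable_collected_threshold_policy:
  assumes "k \<ge> 1" "n \<ge> 1"
  shows "(\<lambda>\<tau>. collected k n q (threshold_policy k n (\<lambda>_. \<tau>)))
    \<in> borel_measurable (restrict_space borel {0..1})"
proof -
  note [measurable] = measurable_threshold_policy[OF assms]
  show ?thesis unfolding collected_def by measurable
qed

section \<open>Identically distributed agents: constraints, thresholds and quantiles\<close>

lemma iid_constraint:
  assumes G: "(m, G) \<in> iid_type_dists n" "n \<ge> 1" and j: "j \<in> {1..m}"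
  shows "Q_inner b k n G j = Q_iid b k n (G 1 j)"
    and "collected k n (\<lambda>i. G i j) p = collected k n (\<lambda>_. G 1 j) p"
proof -
  note D = iid_type_distsD[OF G]
  have eq: "G i j = G 1 j" if "i \<in> {1..n}" for i using D(4)[OF that, of j] j by simp
  show "Q_inner b k n G j = Q_iid b k n (G 1 j)"
    using D(6)[of j] j by (intro Q_inner_eq_Q_iid eq) auto
  show "collected k n (\<lambda>i. G i j) p = collected k n (\<lambda>_. G 1 j) p"
    by (intro collected_cong eq)
qed

lemma iid_interpolated:
  assumes G: "(m, G) \<in> iid_type_dists n" "n \<ge> 1" and J: "J \<in> {1..m}"
  shows "follows_thresholds k n (interpolated G J \<rho>) = follows_thresholds k n (\<lambda>_. interpolated G J \<rho> 1)"
    and "threshold_policy k n (interpolated G J \<rho>) = threshold_policy k n (\<lambda>_. interpolated G J \<rho> 1)"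
proof -
  have "interpolated G J \<rho> i = interpolated G J \<rho> 1" if "i \<in> {1..n}" for i
  proof -
    have "J \<le> m" "J - 1 \<le> m" using J by auto
    then show ?thesis
      using iid_type_distsD(4)[OF G that, of J] iid_type_distsD(4)[OF G that, of "J - 1"]
      by (simp add: interpolated_def)
  qed
  then show *: "follows_thresholds k n (interpolated G J \<rho>) =
      follows_thresholds k n (\<lambda>_. interpolated G J \<rho> 1)"
    by (rule follows_thresholds_cong)
  show "threshold_policy k n (interpolated G J \<rho>) = threshold_policy k n (\<lambda>_. interpolated G J \<rho> 1)"
    by (simp add: threshold_policy_def *)
qed

lemma interpolated_bounds:
  assumes G: "(m, G) \<in> iid_type_dists n" "n \<ge> 1" and J: "J \<in> {1..m}" and \<rho>: "\<rho> \<in> {0<..1}"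
  shows "interpolated G J \<rho> 1 \<in> {0..1}"
proof -
  have *: "G 1 (J - 1) \<in> {0..1}" "G 1 J \<in> {0..1}" using iid_type_distsD(6)[OF G] J by auto
  then have "(1 - \<rho>) * G 1 (J - 1) \<le> (1 - \<rho>) * 1"
    using \<rho> by (intro mult_left_mono) auto
  moreover have "\<rho> * G 1 J \<le> \<rho> * 1"
    using * \<rho> by (intro mult_left_mono) auto
  ultimately have "(1 - \<rho>) * G 1 (J - 1) + \<rho> * G 1 J \<le> (1 - \<rho>) * 1 + \<rho> * 1"
    by (rule add_mono)
  then have "interpolated G J \<rho> 1 \<le> 1" by (simp add: interpolated_def)
  then show ?thesis using * \<rho> by (simp add: interpolated_def)
qed

text \<open>A general \<open>G\<close> can interpolate to 0, namely when \<open>G 1 J = 0\<close>,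
  but 0 is not an admissible \<tau>. On the grid, \<open>J \<ge> 1\<close> and
  \<open>\<rho> > 0\<close> exclude this.\<close>

lemma interpolated_geometric_grid:
  assumes r: "0 < r" "r < 1" and J: "J \<in> {1..m}" and \<rho>: "\<rho> \<in> {0<..1}"
  shows "interpolated (geometric_grid r m) J \<rho> 1 \<in> {0<..1}"
proof -
  have "interpolated (geometric_grid r m) J \<rho> 1 \<in> {0..1}"
    using r J \<rho> by (intro interpolated_bounds[of m _ 1] geometric_grid_iid) auto
  moreover have "0 < interpolated (geometric_grid r m) J \<rho> 1"
    using r J \<rho> unfolding interpolated_def geometric_grid_def
    by (intro add_nonneg_pos mult_nonneg_nonneg mult_pos_pos) auto
  ultimately show ?thesis by simp
qed

text \<open>The generalized inverse of the distribution function \<open>G 1\<close>.\<close>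

definition quantile_type :: "(nat \<Rightarrow> nat \<Rightarrow> real) \<Rightarrow> real \<Rightarrow> nat" where
  "quantile_type G \<tau> = (LEAST j. \<tau> \<le> G 1 j)"

text \<open>The relative position of \<tau> in its cell; with \<open>quantile_type\<close> it forms
  a right inverse of interpolation.\<close>

definition quantile_weight :: "(nat \<Rightarrow> nat \<Rightarrow> real) \<Rightarrow> real \<Rightarrow> real" where
  "quantile_weight G \<tau> = (\<tau> - G 1 (quantile_type G \<tau> - 1)) /
     (G 1 (quantile_type G \<tau>) - G 1 (quantile_type G \<tau> - 1))"

lemma quantile_props:
  assumes G: "(m, G) \<in> iid_type_dists n" "n \<ge> 1" and \<tau>: "\<tau> \<in> {0<..1}"
  shows "quantile_type G \<tau> \<in> {1..m}" "quantile_weight G \<tau> \<in> {0<..1}"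
    and "interpolated G (quantile_type G \<tau>) (quantile_weight G \<tau>) 1 = \<tau>"
proof -
  let ?J = "quantile_type G \<tau>"
  have ex: "\<tau> \<le> G 1 m" using iid_type_distsD(3)[OF G] \<tau> by simp
  have le: "\<tau> \<le> G 1 ?J" unfolding quantile_type_def using ex by (rule LeastI)
  have Jm: "?J \<le> m" unfolding quantile_type_def using ex by (rule Least_le)
  have "?J \<noteq> 0" using le iid_type_distsD(2)[OF G] \<tau> by (intro notI) simp
  then show "?J \<in> {1..m}" using Jm by simp
  \<comment> \<open>Minimality gives the strict inequality that makes the cell nondegenerate, even
    if \<open>G 1\<close> has repeated values, and the weight positive.\<close>
  have "\<not> \<tau> \<le> G 1 (?J - 1)"
    using \<open>?J \<noteq> 0\<close> unfolding quantile_type_def by (intro not_less_Least) auto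
  then have *: "G 1 (?J - 1) < \<tau>" by simp
  then show "quantile_weight G \<tau> \<in> {0<..1}"
    using le by (auto simp: quantile_weight_def divide_simps)
  have "interpolated G ?J (quantile_weight G \<tau>) 1 =
      G 1 (?J - 1) + quantile_weight G \<tau> * (G 1 ?J - G 1 (?J - 1))"
    by (simp add: interpolated_def algebra_simps)
  also have "\<dots> = \<tau>" using * le by (simp add: quantile_weight_def)
  finally show "interpolated G ?J (quantile_weight G \<tau>) 1 = \<tau>" .
qed

section \<open>From feasibility on the grid to the infimum over type distributions\<close>

text \<open>The interface to the three problems: \<open>L\<close> is to be a semi-infinite value,
  and its last hypothesis says that feasibility of \<theta> for the reward \<open>C\<close>
  certifies \<open>\<theta> \<le> L\<close>.\<close>

lemma geometric_grid_scaled_le: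
  fixes r :: real and C :: "real \<Rightarrow> real"
  assumes r: "0 < r" "r < 1"
    and m: "m \<ge> 1" "r ^ (m - 1) * n \<le> 1 - r" and k: "k \<ge> 1" "n \<ge> 1"
    and scale: "\<And>c q. 0 \<le> c \<Longrightarrow> c \<le> 1 \<Longrightarrow> 0 \<le> q \<Longrightarrow> q \<le> 1 \<Longrightarrow> c * C q \<le> C (c * q)"
    and \<theta>: "\<And>j. j \<in> {1..m} \<Longrightarrow>
      \<theta> * Q_inner b k n (geometric_grid r m) j \<le> C (geometric_grid r m 1 j)"
    and L: "0 \<le> L" "\<And>\<theta>. \<forall>q\<in>{0<..1}. \<theta> * Q_iid b k n q \<le> C q \<Longrightarrow> ereal \<theta> \<le> L"
  shows "ereal \<theta> \<le> L / ereal r"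
proof -
  have "ereal (r * \<theta>) \<le> L"
  proof (cases "0 \<le> \<theta>")
    case True
    have "\<theta> * Q_iid b k n (r ^ (m - j)) \<le> C (r ^ (m - j))" if "j \<in> {1..m}" for j
      using \<theta>[OF that] iid_constraint(1)[OF geometric_grid_iid k(2) that, of r b k] r m that
      by (simp add: geometric_grid_def)
    from geometric_grid_feasible[OF r m k scale True this]
    show ?thesis by (intro L) auto
  next
    \<comment> \<open>The grid argument multiplies inequalities by \<theta>; negative \<theta> are
      covered by \<open>0 \<le> L\<close> instead.\<close>
    case False
    then have "ereal (r * \<theta>) \<le> 0" using r by (simp add: mult_le_0_iff)
    then show ?thesis using L(1) by (rule order_trans)
  qed
  then show ?thesis using r by (subst ereal_le_divide_pos) auto
qed

lemma INF_iid_le_if_geometric_grid_le: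
  fixes F :: "nat \<times> (nat \<Rightarrow> nat \<Rightarrow> real) \<Rightarrow> ereal"
  assumes "0 \<le> L"
    and "\<And>r m. 0 < r \<Longrightarrow> r < 1 \<Longrightarrow> m \<ge> 1 \<Longrightarrow> r ^ (m - 1) * real n \<le> 1 - r \<Longrightarrow>
      F (m, geometric_grid r m) \<le> L / ereal r"
  shows "(INF G\<in>iid_type_dists n. F G) \<le> L"
proof (rule INF_le_if_scaled[OF assms(1)])
  fix r :: real assume r: "0 < r" "r < 1"
  then obtain m where "m \<ge> 1" "r ^ (m - 1) * real n \<le> 1 - r"
    using ex_geometric_grid by blast
  then show "\<exists>G\<in>iid_type_dists n. F G \<le> L / ereal r"
    using r assms(2) geometric_grid_iid by blast
qed

section \<open>Dynamic programs\<close>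

lemma innerLP_DP_ge:
  assumes G: "(m, G) \<in> iid_type_dists n" "n \<ge> 1"
  shows "iidLP_DP b k n \<le> innerLP_DP b k n m G"
  unfolding iidLP_DP_def innerLP_DP_def
proof (intro Sup_subset_mono subsetI; clarify)
  fix \<theta> x y
  assume xy: "(x, y) \<in> P_set k n"
    and \<theta>: "\<forall>q\<in>{0<..1}. \<theta> * Q_iid b k n q \<le> collected k n (\<lambda>_. q) (x, y)"
  have "\<theta> * Q_inner b k n G j \<le> collected k n (\<lambda>i. G i j) (x, y)" if j: "j \<in> {1..m}" for j
  \<comment> \<open>A type with value 0 has no semi-infinite counterpart, but its constraint reads
    \<open>0 \<le> 0\<close>.\<close>
  proof (cases "G 1 j = 0")
    case True
    then show ?thesis using collected_0[OF xy] by (simp add: iid_constraint[OF G j])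
  next
    case False
    then show ?thesis
      using \<theta> iid_type_distsD(6)[OF G, of j] j by (simp add: iid_constraint[OF G j])
  qed
  then show "\<exists>\<theta>' x y. ereal \<theta> = ereal \<theta>' \<and> (x, y) \<in> P_set k n \<and>
    (\<forall>j\<in>{1..m}. \<theta>' * Q_inner b k n G j \<le> collected k n (\<lambda>i. G i j) (x, y))"
    using xy by blast
qed

text \<open>\<open>\<theta> = 0\<close> is feasible for the threshold policy. The sign of the value
  is a premise of the grid argument; for \<open>iidLP_DP\<close> it follows because that problem is
  a relaxation.\<close>

lemma iidLP_OST_nonneg:
  assumes "k \<ge> 1" "n \<ge> 1" "\<tau> \<in> {0<..1}"
  shows "0 \<le> iidLP_OST \<tau> b k n"
proof -
  let ?p = "threshold_policy k n (\<lambda>_. \<tau>)"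
  have "(fst ?p, snd ?p) \<in> P_set k n" "follows_thresholds k n (\<lambda>_. \<tau>) (fst ?p) (snd ?p)"
    using threshold_policy_props[of k n "\<lambda>_. \<tau>"] assms by auto
  moreover from this have "\<forall>q\<in>{0<..1}. 0 * Q_iid b k n q \<le> collected k n (\<lambda>_. q) (fst ?p, snd ?p)"
    using collected_nonneg by simp
  ultimately show ?thesis
    unfolding iidLP_OST_def zero_ereal_def by (intro Sup_upper) blast
qed

lemma iidLP_OST_le_DP: "iidLP_OST \<tau> b k n \<le> iidLP_DP b k n"
  unfolding iidLP_OST_def iidLP_DP_def by (intro Sup_subset_mono) blast

lemma INF_innerLP_DP:
  assumes k: "k \<ge> 1" "n \<ge> 1"
  shows "(INF (m, G) \<in> iid_type_dists n. innerLP_DP b k n m G) = iidLP_DP b k n"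
proof (rule antisym)
  have L: "0 \<le> iidLP_DP b k n"
    using iidLP_OST_nonneg[OF k, of 1 b] iidLP_OST_le_DP[of 1 b k n] by simp
  show "(INF (m, G) \<in> iid_type_dists n. innerLP_DP b k n m G) \<le> iidLP_DP b k n"
  proof (rule INF_iid_le_if_geometric_grid_le[OF L], unfold split_conv)
    fix r m assume grid: "0 < r" "r < (1::real)" "m \<ge> 1" "r ^ (m - 1) * real n \<le> 1 - r"
    note G = geometric_grid_iid[OF grid(1-3)]
    show "innerLP_DP b k n m (geometric_grid r m) \<le> iidLP_DP b k n / ereal r"
      unfolding innerLP_DP_def
    proof (intro Sup_least; clarify)
      fix \<theta> x y
      assume xy: "(x, y) \<in> P_set k n"
        and \<theta>: "\<forall>j\<in>{1..m}. \<theta> * Q_inner b k n (geometric_grid r m) j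
          \<le> collected k n (\<lambda>i. geometric_grid r m i j) (x, y)"
      show "ereal \<theta> \<le> iidLP_DP b k n / ereal r"
      \<comment> \<open>The policy stays fixed: \<open>C q\<close> is the reward of this very
        \<open>(x, y)\<close>, and only \<theta> is shrunk.\<close>
      proof (rule geometric_grid_scaled_le[OF grid k _ _ L])
        show "c * collected k n (\<lambda>_. q) (x, y) \<le> collected k n (\<lambda>_. c * q) (x, y)"
          if "0 \<le> c" "c \<le> 1" "0 \<le> q" for c q
          using that by (intro collected_scale xy)
        show "\<theta> * Q_inner b k n (geometric_grid r m) j
            \<le> collected k n (\<lambda>_. geometric_grid r m 1 j) (x, y)" if "j \<in> {1..m}" for j
          using \<theta> that by (simp only: iid_constraint(2)[OF G k(2) that, symmetric])
        show "ereal \<theta>' \<le> iidLP_DP b k n"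
          if "\<forall>q\<in>{0<..1}. \<theta>' * Q_iid b k n q \<le> collected k n (\<lambda>_. q) (x, y)" for \<theta>'
          unfolding iidLP_DP_def using xy that by (intro Sup_upper) blast
      qed
    qed
  qed
  show "iidLP_DP b k n \<le> (INF (m, G) \<in> iid_type_dists n. innerLP_DP b k n m G)"
    using innerLP_DP_ge k by (auto intro!: INF_greatest)
qed

section \<open>Oblivious static thresholds\<close>

lemma innerLP_OST_ge:
  assumes G: "(m, G) \<in> iid_type_dists n" "n \<ge> 1" and J: "J \<in> {1..m}"
  shows "iidLP_OST (interpolated G J \<rho> 1) b k n \<le> innerLP_OST J \<rho> b k n m G"
  unfolding iidLP_OST_def innerLP_OST_def iid_interpolated[OF G J]
proof (intro Sup_subset_mono subsetI; clarify)
  fix \<theta> x y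
  assume xy: "(x, y) \<in> P_set k n" "follows_thresholds k n (\<lambda>_. interpolated G J \<rho> 1) x y"
    and \<theta>: "\<forall>q\<in>{0<..1}. \<theta> * Q_iid b k n q \<le> collected k n (\<lambda>_. q) (x, y)"
  have "\<theta> * Q_inner b k n G j \<le> collected k n (\<lambda>i. G i j) (x, y)" if j: "j \<in> {1..m}" for j
  proof (cases "G 1 j = 0")
    case True
    then show ?thesis using collected_0[OF xy(1)] by (simp add: iid_constraint[OF G j])
  next
    case False
    then show ?thesis
      using \<theta> iid_type_distsD(6)[OF G, of j] j by (simp add: iid_constraint[OF G j])
  qed
  then show "\<exists>\<theta>' x y. ereal \<theta> = ereal \<theta>' \<and> (x, y) \<in> P_set k n \<and>
    (\<forall>j\<in>{1..m}. \<theta>' * Q_inner b k n G j \<le> collected k n (\<lambda>i. G i j) (x, y)) \<and>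
    follows_thresholds k n (\<lambda>_. interpolated G J \<rho> 1) x y"
    using xy by blast
qed

lemma INF_innerLP_OST:
  assumes k: "k \<ge> 1" "n \<ge> 1"
  shows "(INF (m, G) \<in> iid_type_dists n. SUP (J, \<rho>) \<in> {1..m} \<times> {0<..1}. innerLP_OST J \<rho> b k n m G)
    = (SUP \<tau> \<in> {0<..1}. iidLP_OST \<tau> b k n)"
proof (rule antisym)
  let ?L = "SUP \<tau> \<in> {0<..1}. iidLP_OST \<tau> b k n"
  have L: "0 \<le> ?L"
    using iidLP_OST_nonneg[OF k, of 1 b] by (intro SUP_upper2[of 1]) auto
  show "(INF (m, G) \<in> iid_type_dists n. SUP (J, \<rho>) \<in> {1..m} \<times> {0<..1}. innerLP_OST J \<rho> b k n m G) \<le> ?L"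
  proof (rule INF_iid_le_if_geometric_grid_le[OF L], unfold split_conv)
    fix r m assume grid: "0 < r" "r < (1::real)" "m \<ge> 1" "r ^ (m - 1) * real n \<le> 1 - r"
    note G = geometric_grid_iid[OF grid(1-3)]
    show "(SUP (J, \<rho>) \<in> {1..m} \<times> {0<..1}. innerLP_OST J \<rho> b k n m (geometric_grid r m)) \<le> ?L / ereal r"
    proof (intro SUP_least; clarify)
      fix J \<rho> assume J: "J \<in> {1..m}" and \<rho>: "\<rho> \<in> {0<..1::real}"
      let ?\<tau> = "interpolated (geometric_grid r m) J \<rho> 1"
      have \<tau>: "?\<tau> \<in> {0<..1}" by (rule interpolated_geometric_grid[OF grid(1,2) J \<rho>])
      show "innerLP_OST J \<rho> b k n m (geometric_grid r m) \<le> ?L / ereal r"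
        unfolding innerLP_OST_def iid_interpolated[OF G k(2) J]
      proof (intro Sup_least; clarify)
        fix \<theta> x y
        assume xy: "(x, y) \<in> P_set k n" "follows_thresholds k n (\<lambda>_. ?\<tau>) x y"
          and \<theta>: "\<forall>j\<in>{1..m}. \<theta> * Q_inner b k n (geometric_grid r m) j
            \<le> collected k n (\<lambda>i. geometric_grid r m i j) (x, y)"
        show "ereal \<theta> \<le> ?L / ereal r"
        proof (rule geometric_grid_scaled_le[OF grid k _ _ L])
          show "c * collected k n (\<lambda>_. q) (x, y) \<le> collected k n (\<lambda>_. c * q) (x, y)"
            if "0 \<le> c" "c \<le> 1" "0 \<le> q" for c q
            using that by (intro collected_scale xy)
          show "\<theta> * Q_inner b k n (geometric_grid r m) j
              \<le> collected k n (\<lambda>_. geometric_grid r m 1 j) (x, y)" if "j \<in> {1..m}" for j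
            using \<theta> that by (simp only: iid_constraint(2)[OF G k(2) that, symmetric])
          show "ereal \<theta>' \<le> ?L"
            if "\<forall>q\<in>{0<..1}. \<theta>' * Q_iid b k n q \<le> collected k n (\<lambda>_. q) (x, y)" for \<theta>'
          \<comment> \<open>The policy already follows the constant threshold
            \<open>?\<tau>\<close>, which is positive on the grid and so occurs in the
            supremum.\<close>
          proof (rule SUP_upper2[OF \<tau>])
            show "ereal \<theta>' \<le> iidLP_OST ?\<tau> b k n"
              unfolding iidLP_OST_def using xy that by (intro Sup_upper) blast
          qed
        qed
      qed
    qed
  qed
  show "?L \<le> (INF (m, G) \<in> iid_type_dists n. SUP (J, \<rho>) \<in> {1..m} \<times> {0<..1}. innerLP_OST J \<rho> b k n m G)"
  proof (intro INF_greatest SUP_least; clarify)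
    fix m G and \<tau> :: real
    assume G: "(m, G) \<in> iid_type_dists n" and \<tau>: "\<tau> \<in> {0<..1}"
    note q = quantile_props[OF G k(2) \<tau>]
    \<comment> \<open>The pair given by the quantile of \<tau> interpolates back to \<tau>, so both
      problems prescribe the same policy.\<close>
    have "iidLP_OST \<tau> b k n \<le> innerLP_OST (quantile_type G \<tau>) (quantile_weight G \<tau>) b k n m G"
      using innerLP_OST_ge[OF G k(2) q(1), of "quantile_weight G \<tau>" b k] by (simp only: q)
    then show "iidLP_OST \<tau> b k n \<le> (SUP (J, \<rho>) \<in> {1..m} \<times> {0<..1}. innerLP_OST J \<rho> b k n m G)"
      using q by (intro SUP_upper2[of "(quantile_type G \<tau>, quantile_weight G \<tau>)"]) auto
  qed
qed

section \<open>Randomized static thresholds\<close>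

abbreviation type_weight_space :: "nat \<Rightarrow> (nat \<times> real) measure" where
  "type_weight_space m \<equiv> count_space {1..m} \<Otimes>\<^sub>M restrict_space borel {0<..1::real}"

text \<open>The target set is a parameter: [0, 1] serves for measurability and integrability with
  any \<open>G\<close>, and (0, 1] for the push-forward from the grid.\<close>

lemma measurable_interpolated:
  assumes "\<And>J \<rho>. J \<in> {1..m} \<Longrightarrow> \<rho> \<in> {0<..1} \<Longrightarrow> interpolated G J \<rho> 1 \<in> A"
  shows "(\<lambda>(J, \<rho>). interpolated G J \<rho> 1) \<in> type_weight_space m \<rightarrow>\<^sub>M restrict_space borel A"
proof (rule measurable_restrict_space2)
  show "(\<lambda>(J, \<rho>). interpolated G J \<rho> 1) \<in> space (type_weight_space m) \<rightarrow> A"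
    using assms by (auto simp: space_pair_measure)
  have [measurable]: "(\<lambda>z. f (fst z)) \<in> borel_measurable (type_weight_space m)" for f :: "nat \<Rightarrow> real"
    by (rule measurable_compose[OF measurable_fst]) simp
  have [measurable]: "snd \<in> borel_measurable (type_weight_space m)"
    by (rule measurable_compose[OF measurable_snd measurable_restrict_space1[OF measurable_ident_sets[OF refl]]])
  have "(\<lambda>z. (1 - snd z) * G 1 (fst z - 1) + snd z * G 1 (fst z))
      \<in> borel_measurable (type_weight_space m)"
    by measurable
  then show "(\<lambda>(J, \<rho>). interpolated G J \<rho> 1) \<in> borel_measurable (type_weight_space m)"
    by (simp only: interpolated_def case_prod_beta')
qed

text \<open>The type is a least index over countably many measurable conditions, and the weight is
  arithmetic in \<tau> and values of \<open>G 1\<close> at that index.\<close>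

lemma measurable_quantile:
  assumes G: "(m, G) \<in> iid_type_dists n" "n \<ge> 1"
  shows "(\<lambda>\<tau>. (quantile_type G \<tau>, quantile_weight G \<tau>))
    \<in> restrict_space borel {0<..1} \<rightarrow>\<^sub>M type_weight_space m"
proof -
  let ?M = "restrict_space borel {0<..1::real}"
  have [measurable]: "(\<lambda>\<tau>. \<tau>) \<in> borel_measurable ?M"
    by (intro measurable_restrict_space1) simp
  have type: "quantile_type G \<in> ?M \<rightarrow>\<^sub>M count_space UNIV"
    unfolding quantile_type_def by measurable
  have [measurable]: "(\<lambda>\<tau>. f (quantile_type G \<tau>)) \<in> borel_measurable ?M" for f :: "nat \<Rightarrow> real"
    by (rule measurable_compose[OF type]) simp
  have weight: "quantile_weight G \<in> borel_measurable ?M"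
    unfolding quantile_weight_def by measurable
  have "quantile_type G \<in> ?M \<rightarrow>\<^sub>M restrict_space (count_space UNIV) {1..m}"
    using quantile_props(1)[OF G] by (intro measurable_restrict_space2 type) auto
  moreover have "quantile_weight G \<in> ?M \<rightarrow>\<^sub>M restrict_space borel {0<..1}"
    using quantile_props(2)[OF G] by (intro measurable_restrict_space2 weight) auto
  ultimately show ?thesis
    by (intro measurable_Pair) (auto simp: restrict_count_space)
qed

text \<open>The integrand depends on the pair only through its interpolated threshold. This is
  claimed on the space only, where the agents' values agree.\<close>

lemma inner_ST_integrand:
  assumes G: "(m, G) \<in> iid_type_dists n" "n \<ge> 1" and j: "j \<in> {1..m}"
    and z: "z \<in> space (type_weight_space m)"
  shows "(case z of (J, \<rho>) \<Rightarrow> collected k n (\<lambda>i. G i j) (threshold_policy k n (interpolated G J \<rho>)))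
    = collected k n (\<lambda>_. G 1 j) (threshold_policy k n (\<lambda>_. case z of (J, \<rho>) \<Rightarrow> interpolated G J \<rho> 1))"
  using z iid_interpolated(2)[OF G] iid_constraint(2)[OF G j]
  by (auto simp: space_pair_measure)

lemma innerLP_ST_ge:
  assumes G: "(m, G) \<in> iid_type_dists n" and k: "k \<ge> 1" "n \<ge> 1"
  shows "iidLP_ST b k n \<le> innerLP_ST b k n m G"
  unfolding iidLP_ST_def innerLP_ST_def
proof (intro Sup_subset_mono subsetI; clarify)
  let ?R = "\<lambda>q \<tau>. collected k n (\<lambda>_. q) (threshold_policy k n (\<lambda>_. \<tau>))"
  let ?h = "\<lambda>(J, \<rho>). interpolated G J \<rho> 1"
  let ?\<phi> = "\<lambda>\<tau>. (quantile_type G \<tau>, quantile_weight G \<tau>)"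
  let ?g = "\<lambda>j (J, \<rho>). collected k n (\<lambda>i. G i j) (threshold_policy k n (interpolated G J \<rho>))"
  fix \<theta> :: real and \<mu> :: "real measure"
  assume \<mu>: "prob_space \<mu>" "sets \<mu> = sets (restrict_space borel {0<..1})"
    and \<theta>: "\<forall>q\<in>{0<..1}. \<theta> * Q_iid b k n q \<le> (\<integral>\<tau>. ?R q \<tau> \<partial>\<mu>)"
  have space: "space \<mu> = {0<..1}" using sets_eq_imp_space_eq[OF \<mu>(2)] by simp
  have \<phi> [measurable]: "?\<phi> \<in> \<mu> \<rightarrow>\<^sub>M type_weight_space m"
    using measurable_quantile[OF G k(2)] \<mu>(2) by (simp cong: measurable_cong_sets)
  \<comment> \<open>Since interpolation undoes \<open>?\<phi>\<close>, a pair drawn from this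
    measure induces a threshold with law \<open>\<mu>\<close>, and all expected rewards are
    preserved.\<close>
  define \<nu> where "\<nu> = distr \<mu> (type_weight_space m) ?\<phi>"
  have "prob_space \<nu>" unfolding \<nu>_def using \<mu>(1) \<phi> by (rule prob_space.prob_space_distr)
  moreover have "sets \<nu> = sets (type_weight_space m)" unfolding \<nu>_def by (rule sets_distr)
  moreover have "\<theta> * Q_inner b k n G j \<le> (\<integral>z. ?g j z \<partial>\<nu>)" if j: "j \<in> {1..m}" for j
  proof -
    have R: "(\<lambda>z. ?R (G 1 j) (?h z)) \<in> borel_measurable (type_weight_space m)"
      by (rule measurable_compose[OF measurable_interpolated[OF interpolated_bounds[OF G k(2)]]
            measurable_collected_threshold_policy[OF k]])
    have "?g j \<in> borel_measurable (type_weight_space m) \<longleftrightarrow>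
        (\<lambda>z. ?R (G 1 j) (?h z)) \<in> borel_measurable (type_weight_space m)"
      by (rule measurable_cong) (rule inner_ST_integrand[OF G k(2) j])
    from iffD2[OF this R] have g: "?g j \<in> borel_measurable (type_weight_space m)" .
    have "(\<integral>z. ?g j z \<partial>\<nu>) = (\<integral>\<tau>. ?g j (?\<phi> \<tau>) \<partial>\<mu>)"
      unfolding \<nu>_def by (rule integral_distr[OF \<phi> g])
    also have "\<dots> = (\<integral>\<tau>. ?R (G 1 j) \<tau> \<partial>\<mu>)"
    proof (rule Bochner_Integration.integral_cong[OF refl])
      fix \<tau> assume \<tau>: "\<tau> \<in> space \<mu>"
      then show "?g j (?\<phi> \<tau>) = ?R (G 1 j) \<tau>"
        using inner_ST_integrand[OF G k(2) j measurable_space[OF \<phi> \<tau>], of k]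
          quantile_props(3)[OF G k(2), of \<tau>]
        by (simp only: split_conv space)
    qed
    finally have int: "(\<integral>z. ?g j z \<partial>\<nu>) = (\<integral>\<tau>. ?R (G 1 j) \<tau> \<partial>\<mu>)" .
    show ?thesis
    proof (cases "G 1 j = 0")
      case True
      have "?R 0 \<tau> = 0" if "\<tau> \<in> space \<mu>" for \<tau>
        using that k by (intro collected_0 threshold_policy_props) (auto simp: space)
      then have "(\<integral>\<tau>. ?R 0 \<tau> \<partial>\<mu>) = (\<integral>\<tau>. 0 \<partial>\<mu>)"
        by (intro Bochner_Integration.integral_cong) auto
      then show ?thesis unfolding int iid_constraint(1)[OF G k(2) j] True by simp
    next
      case False
      then show ?thesis
        using \<theta> iid_type_distsD(6)[OF G k(2), of j] j
        unfolding int by (simp add: iid_constraint(1)[OF G k(2) j])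
    qed
  qed
  ultimately show "\<exists>\<theta>' \<nu>. ereal \<theta> = ereal \<theta>' \<and> prob_space \<nu> \<and>
    sets \<nu> = sets (type_weight_space m) \<and>
    (\<forall>j\<in>{1..m}. \<theta>' * Q_inner b k n G j \<le> (\<integral>z. ?g j z \<partial>\<nu>))"
    by blast
qed

lemma iidLP_ST_nonneg:
  assumes k: "k \<ge> 1" "n \<ge> 1"
  shows "0 \<le> iidLP_ST b k n"
proof -
  let ?M = "restrict_space borel {0<..1::real}"
  let ?R = "\<lambda>q \<tau>. collected k n (\<lambda>_. q) (threshold_policy k n (\<lambda>_. \<tau>))"
  have "prob_space (return ?M 1)" by (intro prob_space_return) simp
  moreover have "sets (return ?M 1) = sets ?M" by simp
  moreover have "\<forall>q\<in>{0<..1}. 0 * Q_iid b k n q \<le> (\<integral>\<tau>. ?R q \<tau> \<partial>return ?M 1)"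
  proof
    fix q :: real assume q: "q \<in> {0<..1}"
    have "0 \<le> (\<integral>\<tau>. ?R q \<tau> \<partial>return ?M 1)"
      using q k by (intro Bochner_Integration.integral_nonneg collected_nonneg threshold_policy_props) auto
    then show "0 * Q_iid b k n q \<le> (\<integral>\<tau>. ?R q \<tau> \<partial>return ?M 1)" by simp
  qed
  ultimately show ?thesis
    unfolding iidLP_ST_def zero_ereal_def by (intro Sup_upper) blast
qed

text \<open>Boundedness by a policy-independent constant; monotonicity of the integral in the
  averaged scaling inequality rests on this.\<close>

lemma integrable_collected_threshold_policy:
  assumes k: "k \<ge> 1" "n \<ge> 1" and q: "0 \<le> q" and \<mu>: "finite_measure \<mu>"
    and h: "h \<in> \<mu> \<rightarrow>\<^sub>M restrict_space borel {0..1}"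
  shows "integrable \<mu> (\<lambda>z. collected k n (\<lambda>_. q) (threshold_policy k n (\<lambda>_. h z)))"
proof (rule finite_measure.integrable_const_bound[OF \<mu>])
  have P: "threshold_policy k n (\<lambda>_. h z) \<in> P_set k n" if "z \<in> space \<mu>" for z
    using measurable_space[OF h that] k by (intro threshold_policy_props) auto
  show "AE z in \<mu>. norm (collected k n (\<lambda>_. q) (threshold_policy k n (\<lambda>_. h z)))
      \<le> (\<Sum>i = 1..n. \<Sum>l = 1..k. 2 ^ i)"
    using collected_nonneg[OF P q] collected_le[OF P] by (intro AE_I2) simp
  show "(\<lambda>z. collected k n (\<lambda>_. q) (threshold_policy k n (\<lambda>_. h z))) \<in> borel_measurable \<mu>"
    by (rule measurable_compose[OF h measurable_collected_threshold_policy[OF k]])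
qed

lemma INF_innerLP_ST:
  assumes k: "k \<ge> 1" "n \<ge> 1"
  shows "(INF (m, G) \<in> iid_type_dists n. innerLP_ST b k n m G) = iidLP_ST b k n"
proof (rule antisym)
  let ?R = "\<lambda>q \<tau>. collected k n (\<lambda>_. q) (threshold_policy k n (\<lambda>_. \<tau>))"
  note L = iidLP_ST_nonneg[OF k, of b]
  show "(INF (m, G) \<in> iid_type_dists n. innerLP_ST b k n m G) \<le> iidLP_ST b k n"
  proof (rule INF_iid_le_if_geometric_grid_le[OF L], unfold split_conv)
    fix r m assume grid: "0 < r" "r < (1::real)" "m \<ge> 1" "r ^ (m - 1) * real n \<le> 1 - r"
    define G where "G = geometric_grid r m"
    have G: "(m, G) \<in> iid_type_dists n" unfolding G_def by (rule geometric_grid_iid[OF grid(1-3)])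
    let ?h = "\<lambda>(J, \<rho>). interpolated G J \<rho> 1"
    let ?g = "\<lambda>j (J, \<rho>). collected k n (\<lambda>i. G i j) (threshold_policy k n (interpolated G J \<rho>))"
    show "innerLP_ST b k n m (geometric_grid r m) \<le> iidLP_ST b k n / ereal r"
      unfolding innerLP_ST_def G_def[symmetric]
    proof (intro Sup_least; clarify)
      fix \<theta> :: real and \<mu> :: "(nat \<times> real) measure"
      assume \<mu>: "prob_space \<mu>" "sets \<mu> = sets (type_weight_space m)"
        and \<theta>: "\<forall>j\<in>{1..m}. \<theta> * Q_inner b k n G j \<le> (\<integral>z. ?g j z \<partial>\<mu>)"
      interpret prob_space \<mu> by (rule \<mu>(1))
      note space = sets_eq_imp_space_eq[OF \<mu>(2)]
      have h0: "?h \<in> \<mu> \<rightarrow>\<^sub>M restrict_space borel {0..1}"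
        using measurable_interpolated[OF interpolated_bounds[OF G k(2)], of m] \<mu>(2)
        by (simp cong: measurable_cong_sets)
      have h1: "?h \<in> \<mu> \<rightarrow>\<^sub>M restrict_space borel {0<..1}"
        using measurable_interpolated[OF interpolated_geometric_grid[OF grid(1,2)], of m m] \<mu>(2)
        by (simp add: G_def cong: measurable_cong_sets)
      \<comment> \<open>The reward averaged over the random threshold; it inherits the scaling
        inequality pointwise under the integral.\<close>
      define C where "C q = (\<integral>z. ?R q (?h z) \<partial>\<mu>)" for q
      show "ereal \<theta> \<le> iidLP_ST b k n / ereal r"
      proof (rule geometric_grid_scaled_le[OF grid k _ _ L])
        show "c * C q \<le> C (c * q)" if "0 \<le> c" "c \<le> 1" "0 \<le> q" for c q
        proof -
          have "c * C q = (\<integral>z. c * ?R q (?h z) \<partial>\<mu>)" by (simp add: C_def)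
          also have "\<dots> \<le> C (c * q)"
            unfolding C_def
          proof (rule integral_mono)
            show "integrable \<mu> (\<lambda>z. c * ?R q (?h z))" "integrable \<mu> (\<lambda>z. ?R (c * q) (?h z))"
              using that finite_measure_axioms
              by (intro integrable_mult_right integrable_collected_threshold_policy k h0; simp)+
            show "c * ?R q (?h z) \<le> ?R (c * q) (?h z)" if "z \<in> space \<mu>" for z
              using measurable_space[OF h0 that] \<open>0 \<le> c\<close> \<open>c \<le> 1\<close> \<open>0 \<le> q\<close> k
              by (intro collected_scale threshold_policy_props) auto
          qed
          finally show ?thesis .
        qed
        show "\<theta> * Q_inner b k n (geometric_grid r m) j \<le> C (geometric_grid r m 1 j)"
          if j: "j \<in> {1..m}" for j
        proof -
          have "(\<integral>z. ?g j z \<partial>\<mu>) = C (G 1 j)"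
            unfolding C_def using inner_ST_integrand[OF G k(2) j]
            by (intro Bochner_Integration.integral_cong) (simp_all only: space)
          then show ?thesis using bspec[OF \<theta> j] unfolding G_def[symmetric] by (simp only:)
        qed
        show "ereal \<theta>' \<le> iidLP_ST b k n"
          if \<theta>': "\<forall>q\<in>{0<..1}. \<theta>' * Q_iid b k n q \<le> C q" for \<theta>'
        proof -
          \<comment> \<open>The law of the interpolated threshold; positivity on the grid makes it a
            measure on (0, 1], and its expected reward at \<open>q\<close> is
            \<open>C q\<close>.\<close>
          define \<nu> where "\<nu> = distr \<mu> (restrict_space borel {0<..1}) ?h"
          have "prob_space \<nu>" unfolding \<nu>_def by (rule prob_space_distr[OF h1])
          moreover have "sets \<nu> = sets (restrict_space borel {0<..1})" by (simp add: \<nu>_def)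
          moreover have "(\<integral>\<tau>. ?R q \<tau> \<partial>\<nu>) = C q" for q
          proof -
            have "?R q \<in> borel_measurable (restrict_space borel {0<..1})"
              by (rule measurable_restrict_mono[OF measurable_collected_threshold_policy[OF k]]) auto
            then show ?thesis unfolding \<nu>_def C_def by (rule integral_distr[OF h1])
          qed
          ultimately show ?thesis
            unfolding iidLP_ST_def using \<theta>' by (intro Sup_upper) (auto intro!: exI[of _ \<nu>])
        qed
      qed
    qed
  qed
  show "iidLP_ST b k n \<le> (INF (m, G) \<in> iid_type_dists n. innerLP_ST b k n m G)"
    using innerLP_ST_ge k by (auto intro!: INF_greatest)
qed

theorem theorem7:
  fixes k n :: nat
  assumes "k \<ge> 1" and "n > k"
  shows "((INF (m, G) \<in> iid_type_dists n. innerLP_DP Proph k n m G) = iidLP_DP Proph k n)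
    \<and> ((INF (m, G) \<in> iid_type_dists n. innerLP_DP ExAnte k n m G) = iidLP_DP ExAnte k n)
    \<and> ((INF (m, G) \<in> iid_type_dists n. SUP (J, \<rho>) \<in> {1..m} \<times> {0<..1}. innerLP_OST J \<rho> Proph k n m G)
        = (SUP \<tau> \<in> {0<..1}. iidLP_OST \<tau> Proph k n))
    \<and> ((INF (m, G) \<in> iid_type_dists n. SUP (J, \<rho>) \<in> {1..m} \<times> {0<..1}. innerLP_OST J \<rho> ExAnte k n m G)
        = (SUP \<tau> \<in> {0<..1}. iidLP_OST \<tau> ExAnte k n))
    \<and> ((INF (m, G) \<in> iid_type_dists n. innerLP_ST Proph k n m G) = iidLP_ST Proph k n)
    \<and> ((INF (m, G) \<in> iid_type_dists n. innerLP_ST ExAnte k n m G) = iidLP_ST ExAnte k n)"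
  using assms by (intro conjI INF_innerLP_DP INF_innerLP_OST INF_innerLP_ST) auto

end
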